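(* Let $(\mathbb{R}^2,\|\cdot\|)$ be a smooth Minkowski plane and let $w(t)=d+ht$ be a linear weight function with $d>0$ and $h\ge 0$. Then every Steiner point in a minimum Gilbert arborescence in $(\mathbb{R}^2,\|\cdot\|)$ with weight function $w$ has degree $3$.
   Context: A Minkowski plane is $\mathbb{R}^2$ endowed with a norm $\|\cdot\|$. It is smooth if the norm is differentiable at every $x\ne o$, where $o$ is the origin. Gilbert arborescences: given a set of terminals consisting of sources $p_1,\dots,p_n$ with positive flow demands $t_1,\dots,t_n$ and a sink $q$, a Gilbert arborescence is a finite tree $T$ whose vertices are (distinct) points of the space and include all the terminals, whose edges are straight segments, and in which the flow $t_i$ from $p_i$ is routed along the unique path of $T$ from $p_i$ to $q$; every edge lies on at least one of these paths. Vertices of $T$ that are not terminals are called Steiner points; they may be arbitrary points of the space, in any finite number. The total flow on an edge $e$ is $t_e=\sum t_i$, summed over all $i$ such that $e$ lies on the path from $p_i$ to $q$. The cost of an edge $e=xy$ is $w(t_e)\|x-y\|$, and the cost of $T$ is the sum of the costs of its edges. A minimum Gilbert arborescence is a Gilbert arborescence of minimum cost among all Gilbert arborescences with the same terminals, flow demands and weight function. Convention: the statement concerns Steiner points of degree at least $3$ (trivial Steiner points of degree $2$, such as those subdividing an edge, are disregarded). *)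

theory Defs
  imports "HOL-Analysis.Analysis"
begin

section \<open>Minkowski planes\<close>

definition is_norm :: "(real^2 \<Rightarrow> real) \<Rightarrow> bool" where
  "is_norm N \<longleftrightarrow>
     (\<forall>x. 0 \<le> N x) \<and> (\<forall>x. N x = 0 \<longleftrightarrow> x = 0) \<and>
     (\<forall>a x. N (a *\<^sub>R x) = \<bar>a\<bar> * N x) \<and>
     (\<forall>x y. N (x + y) \<le> N x + N y)"

definition smooth_norm :: "(real^2 \<Rightarrow> real) \<Rightarrow> bool" where
  "smooth_norm N \<longleftrightarrow> is_norm N \<and> (\<forall>x. x \<noteq> 0 \<longrightarrow> N differentiable (at x))"


section \<open>Finite simple graphs and trees\<close>

text \<open>A graph is given by its vertex set \<open>V\<close> and its set \<open>E\<close> of undirected edges, an edge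
  being the two-element set of its endpoints.\<close>

definition is_graph :: "'a set \<Rightarrow> 'a set set \<Rightarrow> bool" where
  "is_graph V E \<longleftrightarrow> finite V \<and> (\<forall>e\<in>E. \<exists>x\<in>V. \<exists>y\<in>V. x \<noteq> y \<and> e = {x, y})"

fun walk_edges :: "'a list \<Rightarrow> 'a set list" where
  "walk_edges (x # y # xs) = {x, y} # walk_edges (y # xs)"
| "walk_edges xs = []"

definition is_path :: "'a set \<Rightarrow> 'a set set \<Rightarrow> 'a \<Rightarrow> 'a \<Rightarrow> 'a list \<Rightarrow> bool" where
  "is_path V E x y xs \<longleftrightarrow>
     xs \<noteq> [] \<and> hd xs = x \<and> last xs = y \<and> distinct xs \<and> set xs \<subseteq> V \<and> set (walk_edges xs) \<subseteq> E"

text \<open>A cycle is listed without repetition of its starting vertex.\<close>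

definition is_cycle :: "'a set \<Rightarrow> 'a set set \<Rightarrow> 'a list \<Rightarrow> bool" where
  "is_cycle V E xs \<longleftrightarrow>
     3 \<le> length xs \<and> distinct xs \<and> set xs \<subseteq> V \<and> set (walk_edges (xs @ [hd xs])) \<subseteq> E"

definition is_tree :: "'a set \<Rightarrow> 'a set set \<Rightarrow> bool" where
  "is_tree V E \<longleftrightarrow>
     is_graph V E \<and> V \<noteq> {} \<and>
     (\<forall>x\<in>V. \<forall>y\<in>V. \<exists>xs. is_path V E x y xs) \<and> (\<nexists>xs. is_cycle V E xs)"

definition vertex_degree :: "'a set set \<Rightarrow> 'a \<Rightarrow> nat" where
  "vertex_degree E v = card {e \<in> E. v \<in> e}"

text \<open>This is only meaningful if the path is unique; see \<open>tree_path_unique\<close> below.\<close>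

definition tree_path :: "'a set \<Rightarrow> 'a set set \<Rightarrow> 'a \<Rightarrow> 'a \<Rightarrow> 'a list" where
  "tree_path V E x y = (THE xs. is_path V E x y xs)"


section \<open>Gilbert arborescences\<close>

text \<open>The sources are \<open>p 1, \<dots>, p n\<close> with flow demands \<open>t 1, \<dots>, t n\<close>, and the sink is \<open>q\<close>.\<close>

definition terminals :: "nat \<Rightarrow> (nat \<Rightarrow> 'a) \<Rightarrow> 'a \<Rightarrow> 'a set" where
  "terminals n p q = insert q (p ` {1..n})"

definition edges_to_sink :: "(nat \<Rightarrow> 'a) \<Rightarrow> 'a \<Rightarrow> 'a set \<Rightarrow> 'a set set \<Rightarrow> nat \<Rightarrow> 'a set set" where
  "edges_to_sink p q V E i = set (walk_edges (tree_path V E (p i) q))"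

definition gilbert_arborescence ::
  "nat \<Rightarrow> (nat \<Rightarrow> 'a) \<Rightarrow> 'a \<Rightarrow> 'a set \<Rightarrow> 'a set set \<Rightarrow> bool" where
  "gilbert_arborescence n p q V E \<longleftrightarrow>
     is_tree V E \<and> terminals n p q \<subseteq> V \<and>
     (\<forall>e\<in>E. \<exists>i\<in>{1..n}. e \<in> edges_to_sink p q V E i)"

definition steiner_points :: "nat \<Rightarrow> (nat \<Rightarrow> 'a) \<Rightarrow> 'a \<Rightarrow> 'a set \<Rightarrow> 'a set" where
  "steiner_points n p q V = V - terminals n p q"

definition flow ::
  "nat \<Rightarrow> (nat \<Rightarrow> 'a) \<Rightarrow> (nat \<Rightarrow> real) \<Rightarrow> 'a \<Rightarrow> 'a set \<Rightarrow> 'a set set \<Rightarrow> 'a set \<Rightarrow> real" where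
  "flow n p t q V E e = (\<Sum>i \<in> {i \<in> {1..n}. e \<in> edges_to_sink p q V E i}. t i)"

definition edge_length :: "('a::ab_group_add \<Rightarrow> real) \<Rightarrow> 'a set \<Rightarrow> real" where
  "edge_length N e = (THE l. \<exists>x y. e = {x, y} \<and> l = N (x - y))"

definition cost ::
  "('a::ab_group_add \<Rightarrow> real) \<Rightarrow> (real \<Rightarrow> real) \<Rightarrow>
   nat \<Rightarrow> (nat \<Rightarrow> 'a) \<Rightarrow> (nat \<Rightarrow> real) \<Rightarrow> 'a \<Rightarrow> 'a set \<Rightarrow> 'a set set \<Rightarrow> real" where
  "cost N w n p t q V E = (\<Sum>e\<in>E. w (flow n p t q V E e) * edge_length N e)"

definition minimum_gilbert_arborescence ::
  "('a::ab_group_add \<Rightarrow> real) \<Rightarrow> (real \<Rightarrow> real) \<Rightarrow>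
   nat \<Rightarrow> (nat \<Rightarrow> 'a) \<Rightarrow> (nat \<Rightarrow> real) \<Rightarrow> 'a \<Rightarrow> 'a set \<Rightarrow> 'a set set \<Rightarrow> bool" where
  "minimum_gilbert_arborescence N w n p t q V E \<longleftrightarrow>
     gilbert_arborescence n p q V E \<and>
     (\<forall>V' E'. gilbert_arborescence n p q V' E' \<longrightarrow>
        cost N w n p t q V E \<le> cost N w n p t q V' E')"


section \<open>The definite descriptions are well defined\<close>

lemma edge_length_doubleton:
  assumes "is_norm N"
  shows "edge_length N {x, y} = N (x - y)"
proof -
  have sym: "N (x - y) = N (y - x)" for x y
  proof -
    have "N ((-1) *\<^sub>R (x - y)) = \<bar>-1\<bar> * N (x - y)"
      using assms unfolding is_norm_def by blast
    then show ?thesis by simp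
  qed
  show ?thesis
    unfolding edge_length_def
    by (rule the_equality) (auto simp: doubleton_eq_iff sym)
qed

lemma walk_edges_append:
  "walk_edges (xs @ z # ys) = walk_edges (xs @ [z]) @ walk_edges (z # ys)"
  by (induction xs rule: walk_edges.induct) auto

lemma set_walk_edges_rev: "set (walk_edges (rev xs)) = set (walk_edges xs)"
proof (induction xs rule: walk_edges.induct)
  case (1 x y xs)
  have "walk_edges (rev (x # y # xs)) = walk_edges (rev (y # xs)) @ [{y, x}]"
    using walk_edges_append[of "rev xs" y "[x]"] by simp
  with 1 show ?case by (auto simp: insert_commute)
qed auto

lemma acyclic_path_unique:
  assumes acyclic: "\<nexists>cs. is_cycle V E cs"
  shows "is_path V E x y xs \<Longrightarrow> is_path V E x y ys \<Longrightarrow> xs = ys"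
proof (induction xs arbitrary: x ys)
  case Nil
  then show ?case by (simp add: is_path_def)
next
  case (Cons x' xs)
  from Cons.prems obtain ys' where [simp]: "x' = x" and ys: "ys = x # ys'"
    by (cases ys) (auto simp: is_path_def)
  show ?case
  proof (cases "xs = [] \<or> ys' = []")
    case True
    have "xs = [] \<longleftrightarrow> ys' = []"
      using Cons.prems last_in_set[of xs] last_in_set[of ys']
      by (auto simp: is_path_def ys split: if_splits)
    with True show ?thesis by (simp add: ys)
  next
    case False
    then obtain a as b bs where xs: "xs = a # as" and ys': "ys' = b # bs"
      by (meson list.exhaust)
    show ?thesis
    proof (cases "a = b")
      case True
      have "is_path V E a y xs" "is_path V E a y ys'"
        using Cons.prems True by (auto simp: is_path_def xs ys ys')
      then show ?thesis using Cons.IH by (simp add: ys)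
    next
      case ab: False
      have "last xs = y" "last ys' = y"
        using Cons.prems by (auto simp: is_path_def xs ys ys')
      then have "y \<in> set xs" "y \<in> set ys'"
        using last_in_set[of xs] last_in_set[of ys'] by (auto simp: xs ys')
      then have "\<exists>z\<in>set xs. z \<in> set ys'" by blast
      then obtain A z A' where A: "xs = A @ z # A'" "z \<in> set ys'" "\<forall>u\<in>set A. u \<notin> set ys'"
        using split_list_first_prop[of xs "\<lambda>z. z \<in> set ys'"] by blast
      from \<open>z \<in> set ys'\<close> obtain B B' where B: "ys' = B @ z # B'"
        by (meson split_list)
      define C where "C = x # A @ z # rev B"
      have "\<not> (A = [] \<and> B = [])"
      proof
        assume "A = [] \<and> B = []"
        then have "hd xs = z" "hd ys' = z" by (simp_all add: A(1) B)
        with ab show False by (simp add: xs ys')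
      qed
      then have "3 \<le> length C" by (cases A; cases B) (auto simp: C_def)
      moreover have "distinct C" "set C \<subseteq> V"
        using Cons.prems A(3) by (auto simp: is_path_def ys C_def A(1) B)
      moreover have "set (walk_edges (C @ [hd C])) \<subseteq> E"
      proof -
        have 1: "walk_edges (C @ [hd C]) = walk_edges ((x # A) @ [z]) @ walk_edges (z # rev B @ [x])"
          using walk_edges_append[of "x # A" z "rev B @ [x]"] by (simp add: C_def)
        have 2: "set (walk_edges (z # rev B @ [x])) = set (walk_edges ((x # B) @ [z]))"
          using set_walk_edges_rev[of "x # B @ [z]"] by simp
        have 3: "set (walk_edges ((x # A) @ [z])) \<subseteq> E"
          using Cons.prems(1) walk_edges_append[of "x # A" z A'] by (auto simp: is_path_def A(1))
        have 4: "set (walk_edges ((x # B) @ [z])) \<subseteq> E"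
          using Cons.prems(2) walk_edges_append[of "x # B" z B'] by (auto simp: is_path_def ys B)
        show ?thesis using 1 2 3 4 by simp
      qed
      ultimately have "is_cycle V E C" by (simp add: is_cycle_def)
      with acyclic show ?thesis by blast
    qed
  qed
qed

lemma tree_path_unique:
  assumes "is_tree V E" "x \<in> V" "y \<in> V"
  shows "\<exists>!xs. is_path V E x y xs"
  using assms acyclic_path_unique[of V E x y] unfolding is_tree_def by blast

lemma is_path_tree_path:
  assumes "is_tree V E" "x \<in> V" "y \<in> V"
  shows "is_path V E x y (tree_path V E x y)"
  unfolding tree_path_def using theI'[OF tree_path_unique[OF assms]] .

end

theory Submission
  imports Defs
begin

text \<open>
  Let \<open>s\<close> be a Steiner point. Exactly one edge leaves \<open>s\<close> towards the sink; call its other end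
  \<open>v\<^sub>0\<close> and let \<open>v\<^sub>1, v\<^sub>2, \<dots>\<close> be the neighbours from which flow arrives. Let \<open>\<phi>\<^sub>i\<close> be the gradient
  of the norm at \<open>v\<^sub>i - s\<close>, and let \<open>x\<^sub>i = w(F\<^sub>i) \<phi>\<^sub>i\<close>, where \<open>F\<^sub>i\<close> is the flow on the edge. By
  smoothness, \<open>\<phi>\<^sub>i\<close> is the only functional of dual norm 1 that attains its norm at \<open>v\<^sub>i - s\<close>; this is
  the dual form of strict convexity and makes all equality cases below decisive.

  Detach two neighbours of \<open>s\<close>, attach them to a new vertex close to \<open>s\<close>, and join this vertex to
  \<open>s\<close>. The result is again an arborescence with the same flows on the old edges, so in a minimum
  arborescence its cost is not smaller, and the first variation bounds the dual norm of the sum of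
  the two functionals by the weight of the new edge. Two kinds of pairs suffice:
  \<open>\<parallel>x\<^sub>j + x\<^sub>k\<parallel> \<le> w(F\<^sub>j + F\<^sub>k)\<close> for two incoming edges (lemma \<open>pair_inequality\<close>), and
  \<open>\<parallel>x\<^sub>0 + x\<^sub>k\<parallel> \<le> w(F\<^sub>0 - F\<^sub>k)\<close> for the outgoing and one incoming edge (lemma
  \<open>out_inequality\<close>).

  Because \<open>w\<close> is affine, these two bounds add up to exactly \<open>w(F\<^sub>0) + w(F\<^sub>j) = \<parallel>x\<^sub>0\<parallel> + \<parallel>x\<^sub>j\<parallel>\<close>.
  Now draw a polygonal line from the origin with successive sides \<open>x\<^sub>0, x\<^sub>k, x\<^sub>j\<close> and close it up to
  a quadrilateral. Its diagonals are \<open>x\<^sub>0 + x\<^sub>k\<close> and \<open>x\<^sub>k + x\<^sub>j\<close>. If \<open>\<phi>\<^sub>k\<close> lies in the cone spanned by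
  \<open>\<phi>\<^sub>0\<close> and \<open>\<phi>\<^sub>j\<close>, the diagonals cross, so together they are at least as long as the two opposite
  sides \<open>x\<^sub>0\<close> and \<open>x\<^sub>j\<close>. Hence equality holds throughout, which forces \<open>\<phi>\<^sub>j = -\<phi>\<^sub>0\<close>; and this is
  impossible by another look at the same two bounds (lemmas \<open>not_between\<close>, \<open>not_opposite_out\<close>).

  In the plane such a cone occurs as soon as there are three incoming edges: no \<open>\<phi>\<^sub>i\<close> is parallel to
  \<open>\<phi>\<^sub>0\<close>, so two of them lie strictly on the same side of the line spanned by \<open>\<phi>\<^sub>0\<close>, and one of these
  two is in the cone of \<open>\<phi>\<^sub>0\<close> and the other (lemma \<open>at_most_two_in\<close>). So at most two edges
  arrive at \<open>s\<close>.

  For the combinatorial part the tree is described by the parent of each vertex on its way to the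
  sink, and surgery on the tree is done on the parent map.
\<close>

section \<open>Paths and cycles\<close>

lemma is_path_rev: "is_path V E x y xs \<Longrightarrow> is_path V E y x (rev xs)"
  by (auto simp: is_path_def hd_rev last_rev set_walk_edges_rev)

lemma is_path_suffix: "is_path V E x y (xs @ z # ys) \<Longrightarrow> is_path V E z y (z # ys)"
  using walk_edges_append[of xs z ys] by (auto simp: is_path_def)

lemma is_path_Cons:
  assumes "is_path V E x y xs" "{z, x} \<in> E" "z \<in> V" "z \<notin> set xs"
  shows "is_path V E z y (z # xs)"
  using assms by (cases xs) (auto simp: is_path_def)

text \<open>Existence of a path between two vertices is preserved along edges: if prepending the new vertex
  would repeat it, the part of the path that starts there is used instead.\<close>

lemma is_path_extend:
  assumes "is_path V E x y xs" "{z, x} \<in> E" "z \<in> V"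
  shows "\<exists>ys. is_path V E z y ys"
proof (cases "z \<in> set xs")
  case True
  then obtain as bs where "xs = as @ z # bs" by (meson split_list)
  then show ?thesis using is_path_suffix assms(1) by metis
next
  case False
  then show ?thesis using is_path_Cons assms by metis
qed

lemma walk_edges_nth:
  "Suc i < length xs \<Longrightarrow> {xs ! i, xs ! Suc i} \<in> set (walk_edges xs)"
proof (induction xs arbitrary: i rule: walk_edges.induct)
  case (1 x y xs)
  then show ?case by (cases i) auto
qed auto

lemma is_cycle_neighbours:
  assumes "is_cycle V E xs" "v \<in> set xs"
  obtains a b where "a \<in> set xs" "b \<in> set xs" "a \<noteq> b" "{a, v} \<in> E" "{v, b} \<in> E"
proof -
  let ?m = "length xs"
  have m: "3 \<le> ?m" "distinct xs" and E: "set (walk_edges (xs @ [hd xs])) \<subseteq> E"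
    using assms(1) by (auto simp: is_cycle_def)
  have step: "{xs ! i, xs ! (Suc i mod ?m)} \<in> E" if "i < ?m" for i
  proof (cases "Suc i < ?m")
    case True
    then show ?thesis
      using walk_edges_nth[of i "xs @ [hd xs]"] E by (auto simp: nth_append)
  next
    case False
    with that have i: "Suc i = ?m" by simp
    then have "(xs @ [hd xs]) ! Suc i = xs ! 0" "(xs @ [hd xs]) ! i = xs ! i"
      using m by (auto simp: nth_append intro: hd_conv_nth)
    then show ?thesis
      using walk_edges_nth[of i "xs @ [hd xs]"] E i by auto
  qed
  obtain i where i: "i < ?m" "v = xs ! i" using assms(2) by (metis in_set_conv_nth)
  define j where jj: "j = (if i = 0 then ?m - 1 else i - 1)"
  define k where "k = Suc i mod ?m"
  have kk: "k = (if Suc i = ?m then 0 else Suc i)" using i by (simp add: k_def)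
  have jm: "j < ?m" and km: "k < ?m" and "j \<noteq> k" using i m jj kk by (auto split: if_splits)
  have sj: "Suc j mod ?m = i" using jj i m by (auto split: if_splits)
  show thesis
  proof
    show "xs ! j \<in> set xs" "xs ! k \<in> set xs" using jm km by auto
    show "xs ! j \<noteq> xs ! k" using jm km \<open>j \<noteq> k\<close> m by (simp add: nth_eq_iff_index_eq)
    show "{xs ! j, v} \<in> E" using step[OF jm] sj i by simp
    show "{v, xs ! k} \<in> E" using step[OF i(1)] i k_def by simp
  qed
qed

section \<open>Trees rooted at the sink\<close>

text \<open>A tree rooted at \<open>q\<close> is given by a parent map whose iterates lead to \<open>q\<close>; the rank, which
  decreases along it, certifies this. Since the rank also excludes cycles, being a tree becomes a
  condition on single vertices, which is easy to check after a local modification.\<close>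

locale rooted =
  fixes V :: "'a set" and q :: 'a and par :: "'a \<Rightarrow> 'a" and rk :: "'a \<Rightarrow> nat"
  assumes finite_V: "finite V" and root_in: "q \<in> V"
    and par_in: "v \<in> V \<Longrightarrow> v \<noteq> q \<Longrightarrow> par v \<in> V"
    and rk_par: "v \<in> V \<Longrightarrow> v \<noteq> q \<Longrightarrow> rk (par v) < rk v"
begin

definition arcs :: "('a \<times> 'a) set" where
  "arcs = {(v, par v) | v. v \<in> V - {q}}"

definition edges :: "'a set set" where
  "edges = (\<lambda>v. {v, par v}) ` (V - {q})"

lemma arcsI: "v \<in> V \<Longrightarrow> v \<noteq> q \<Longrightarrow> (v, par v) \<in> arcs"
  by (auto simp: arcs_def)

lemma reach_rk: "(u, v) \<in> arcs\<^sup>* \<Longrightarrow> u = v \<or> rk v < rk u"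
  by (induction rule: rtrancl_induct) (use rk_par in \<open>force simp: arcs_def\<close>)+

lemma reach_in: "(u, v) \<in> arcs\<^sup>* \<Longrightarrow> u \<in> V \<Longrightarrow> v \<in> V"
  by (induction rule: rtrancl_induct) (use par_in in \<open>auto simp: arcs_def\<close>)

lemma reach_step:
  assumes "u \<in> V" "u \<noteq> q"
  shows "(u, v) \<in> arcs\<^sup>* \<longleftrightarrow> v = u \<or> (par u, v) \<in> arcs\<^sup>*"
proof
  assume "(u, v) \<in> arcs\<^sup>*"
  then show "v = u \<or> (par u, v) \<in> arcs\<^sup>*"
    by (rule converse_rtranclE) (auto simp: arcs_def)
next
  assume "v = u \<or> (par u, v) \<in> arcs\<^sup>*"
  then show "(u, v) \<in> arcs\<^sup>*"
    using arcsI[OF assms] by (auto intro: converse_rtrancl_into_rtrancl)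
qed

lemma inj_on_edge: "inj_on (\<lambda>v. {v, par v}) (V - {q})"
proof (rule inj_onI)
  fix u v assume "u \<in> V - {q}" "v \<in> V - {q}" "{u, par u} = {v, par v}"
  then show "u = v" using rk_par[of u] rk_par[of v] by (auto simp: doubleton_eq_iff)
qed

lemma edge_lower: "{u, v} \<in> edges \<Longrightarrow> rk u \<le> rk v \<Longrightarrow> u = par v"
  using rk_par by (force simp: edges_def doubleton_eq_iff)

lemma path_to_root:
  assumes "u \<in> V"
  shows "\<exists>xs. is_path V edges u q xs
    \<and> set (walk_edges xs) = (\<lambda>v. {v, par v}) ` {v. (u, v) \<in> arcs\<^sup>* \<and> v \<noteq> q}
    \<and> (\<forall>x\<in>set xs. rk x \<le> rk u)"
  using assms
proof (induction "rk u" arbitrary: u rule: less_induct)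
  case less
  show ?case
  proof (cases "u = q")
    case True
    have "v = q" if "(q, v) \<in> arcs\<^sup>*" for v
      using that by (rule converse_rtranclE) (auto simp: arcs_def)
    then show ?thesis using True less(2) by (intro exI[of _ "[q]"]) (auto simp: is_path_def)
  next
    case False
    obtain xs where xs: "is_path V edges (par u) q xs"
      "set (walk_edges xs) = (\<lambda>v. {v, par v}) ` {v. (par u, v) \<in> arcs\<^sup>* \<and> v \<noteq> q}"
      "\<forall>x\<in>set xs. rk x \<le> rk (par u)"
      using less(1)[of "par u"] rk_par[OF less(2) False] par_in[OF less(2) False] by blast
    have lt: "\<forall>x\<in>set xs. rk x < rk u"
      using xs(3) rk_par[OF less(2) False] by (meson le_less_trans)
    have e: "{u, par u} \<in> edges" using less(2) False by (auto simp: edges_def)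
    have "is_path V edges u q (u # xs)"
      using is_path_Cons[OF xs(1) e less(2)] lt by blast
    moreover have "set (walk_edges (u # xs)) = insert {u, par u} (set (walk_edges xs))"
      using xs(1) by (cases xs) (auto simp: is_path_def)
    moreover have "{v. (u, v) \<in> arcs\<^sup>* \<and> v \<noteq> q} = insert u {v. (par u, v) \<in> arcs\<^sup>* \<and> v \<noteq> q}"
      using reach_step[OF less(2) False] False by auto
    ultimately show ?thesis using xs(2) lt
      by (intro exI[of _ "u # xs"]) (auto simp: less_imp_le)
  qed
qed

lemma is_tree_edges: "is_tree V edges"
proof -
  have "is_graph V edges"
    using finite_V rk_par par_in by (force simp: is_graph_def edges_def)
  moreover have "\<exists>xs. is_path V edges x y xs" if "x \<in> V" "y \<in> V" for x y
    using that(1)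
  proof (induction "rk x" arbitrary: x rule: less_induct)
    case less
    show ?case
    proof (cases "x = q")
      case True
      then show ?thesis using path_to_root[OF that(2)] is_path_rev by metis
    next
      case False
      then obtain xs where "is_path V edges (par x) y xs"
        using less rk_par par_in by blast
      then show ?thesis using is_path_extend[of V edges "par x" y xs x] less(2) False
        by (auto simp: edges_def)
    qed
  qed
  moreover have "\<not> is_cycle V edges xs" for xs
  proof
    assume c: "is_cycle V edges xs"
    \<comment> \<open>Both neighbours of a vertex of maximal rank would be its parent.\<close>
    have "finite (rk ` set xs)" "rk ` set xs \<noteq> {}" using c by (auto simp: is_cycle_def)
    from Max_in[OF this] obtain v where v: "v \<in> set xs" "rk v = Max (rk ` set xs)" by auto
    then have v_max: "rk u \<le> rk v" if "u \<in> set xs" for u using that by simp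
    obtain a b where "a \<in> set xs" "b \<in> set xs" "a \<noteq> b" "{a, v} \<in> edges" "{v, b} \<in> edges"
      using is_cycle_neighbours[OF c v(1)] .
    then show False using edge_lower[of a v] edge_lower[of b v] v_max
      by (auto simp: insert_commute)
  qed
  ultimately show ?thesis using root_in by (auto simp: is_tree_def)
qed

lemma edges_to_sink_eq:
  assumes "p i \<in> V"
  shows "edges_to_sink p q V edges i = (\<lambda>v. {v, par v}) ` {v. (p i, v) \<in> arcs\<^sup>* \<and> v \<noteq> q}"
proof -
  obtain xs where xs: "is_path V edges (p i) q xs"
    "set (walk_edges xs) = (\<lambda>v. {v, par v}) ` {v. (p i, v) \<in> arcs\<^sup>* \<and> v \<noteq> q}"
    using path_to_root[OF assms] by blast
  have "tree_path V edges (p i) q = xs"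
    using tree_path_unique[OF is_tree_edges assms root_in] xs(1)
      is_path_tree_path[OF is_tree_edges assms root_in] by blast
  then show ?thesis using xs(2) by (simp add: edges_to_sink_def)
qed

lemma edge_in_edges_to_sink:
  assumes "p i \<in> V" "v \<in> V - {q}"
  shows "{v, par v} \<in> edges_to_sink p q V edges i \<longleftrightarrow> (p i, v) \<in> arcs\<^sup>*"
proof -
  have "{v'. (p i, v') \<in> arcs\<^sup>* \<and> v' \<noteq> q} \<subseteq> V - {q}" using reach_in[OF _ assms(1)] by auto
  then show ?thesis
    using inj_on_image_mem_iff[OF inj_on_edge assms(2)] assms(2)
    by (simp add: edges_to_sink_eq[of p i, OF assms(1)])
qed

lemma gilbert_arborescence_edges:
  "gilbert_arborescence n p q V edges \<longleftrightarrow>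
     terminals n p q \<subseteq> V \<and> (\<forall>v\<in>V - {q}. \<exists>i\<in>{1..n}. (p i, v) \<in> arcs\<^sup>*)"
proof (cases "terminals n p q \<subseteq> V")
  case True
  then have p: "p i \<in> V" if "i \<in> {1..n}" for i using that by (auto simp: terminals_def)
  have ball_edges: "(\<forall>e\<in>edges. P e) \<longleftrightarrow> (\<forall>v\<in>V - {q}. P {v, par v})" for P
    by (auto simp: edges_def)
  have "(\<forall>e\<in>edges. \<exists>i\<in>{1..n}. e \<in> edges_to_sink p q V edges i)
      \<longleftrightarrow> (\<forall>v\<in>V - {q}. \<exists>i\<in>{1..n}. (p i, v) \<in> arcs\<^sup>*)"
    unfolding ball_edges by (intro ball_cong bex_cong refl edge_in_edges_to_sink p)
  then show ?thesis using True is_tree_edges by (simp add: gilbert_arborescence_def)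
qed (simp add: gilbert_arborescence_def)

definition load :: "nat \<Rightarrow> (nat \<Rightarrow> 'a) \<Rightarrow> (nat \<Rightarrow> real) \<Rightarrow> 'a \<Rightarrow> real" where
  "load n p t v = (\<Sum>i \<in> {i \<in> {1..n}. (p i, v) \<in> arcs\<^sup>*}. t i)"

lemma flow_edge:
  assumes "terminals n p q \<subseteq> V" "v \<in> V - {q}"
  shows "flow n p t q V edges {v, par v} = load n p t v"
proof -
  have "{i \<in> {1..n}. {v, par v} \<in> edges_to_sink p q V edges i} = {i \<in> {1..n}. (p i, v) \<in> arcs\<^sup>*}"
    using assms edge_in_edges_to_sink[of p _ v] by (force simp: terminals_def)
  then show ?thesis by (simp add: flow_def load_def)
qed

definition children :: "'a \<Rightarrow> 'a set" where
  "children s = {v \<in> V - {q}. par v = s}"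

lemma vertex_degree_le: "vertex_degree edges s \<le> Suc (card (children s))"
proof -
  have fin: "finite (children s)" using finite_V by (auto simp: children_def)
  have "{e \<in> edges. s \<in> e} \<subseteq> insert {s, par s} ((\<lambda>v. {v, par v}) ` children s)"
    by (auto simp: edges_def children_def)
  then have "vertex_degree edges s \<le> card (insert {s, par s} ((\<lambda>v. {v, par v}) ` children s))"
    unfolding vertex_degree_def using fin by (intro card_mono) auto
  also have "\<dots> \<le> Suc (card ((\<lambda>v. {v, par v}) ` children s))"
    using card_insert_le_m1 by (simp add: card_insert_if fin)
  also have "\<dots> \<le> Suc (card (children s))" using card_image_le[OF fin] by auto
  finally show ?thesis .
qed

text \<open>A vertex has only one path to the root, so two siblings on it would be comparable, and then the
  common parent would be a descendant of one of its children.\<close>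

lemma siblings_disjoint:
  assumes "a \<in> children s" "b \<in> children s" "(u, a) \<in> arcs\<^sup>*" "(u, b) \<in> arcs\<^sup>*"
  shows "a = b"
proof -
  have sv: "single_valued arcs" by (auto simp: arcs_def single_valued_def)
  have *: "x = y" if "x \<in> children s" "y \<in> children s" "(x, y) \<in> arcs\<^sup>*" for x y
  proof (rule ccontr)
    assume "x \<noteq> y"
    have "x \<in> V" "x \<noteq> q" "y \<in> V" "y \<noteq> q" "par x = s" "par y = s"
      using that by (auto simp: children_def)
    then show False
      using reach_step[of x y] that(3) \<open>x \<noteq> y\<close> reach_rk[of s y] rk_par[of y] by auto
  qed
  show ?thesis using single_valued_confluent[OF sv assms(3,4)] * assms(1,2) by blast
qed

lemma reach_children:
  assumes "u \<noteq> s" "u \<in> V"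
  shows "(u, s) \<in> arcs\<^sup>* \<longleftrightarrow> (\<exists>c\<in>children s. (u, c) \<in> arcs\<^sup>*)"
proof
  assume "(u, s) \<in> arcs\<^sup>*"
  then obtain c where "(u, c) \<in> arcs\<^sup>*" "(c, s) \<in> arcs" using assms by (meson rtranclE)
  then show "\<exists>c\<in>children s. (u, c) \<in> arcs\<^sup>*" by (auto simp: arcs_def children_def)
next
  assume "\<exists>c\<in>children s. (u, c) \<in> arcs\<^sup>*"
  then show "(u, s) \<in> arcs\<^sup>*"
    by (auto simp: children_def dest: arcsI intro: rtrancl_into_rtrancl)
qed

text \<open>Conservation of flow at a vertex where no source sits.\<close>

lemma load_children:
  assumes "terminals n p q \<subseteq> V - {s}"
  shows "load n p t s = (\<Sum>c\<in>children s. load n p t c)"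
proof -
  have p: "p i \<in> V - {s}" if "i \<in> {1..n}" for i using assms that unfolding terminals_def by blast
  have "{i \<in> {1..n}. (p i, s) \<in> arcs\<^sup>*} = (\<Union>b\<in>children s. {i \<in> {1..n}. (p i, b) \<in> arcs\<^sup>*})"
    using reach_children[of "p _" s] p by auto
  moreover have "finite (children s)" using finite_V by (simp add: children_def)
  moreover have "\<forall>a\<in>children s. \<forall>b\<in>children s. a \<noteq> b \<longrightarrow>
      {i \<in> {1..n}. (p i, a) \<in> arcs\<^sup>*} \<inter> {i \<in> {1..n}. (p i, b) \<in> arcs\<^sup>*} = {}"
    using siblings_disjoint[of _ s] by blast
  ultimately show ?thesis
    unfolding load_def by (simp add: sum.UNION_disjoint)
qed

end

text \<open>The parent of a vertex is its successor on the path to \<open>q\<close>, and the length of that path is a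
  rank. What needs an argument is that no edge is left out.\<close>

lemma is_tree_rooted:
  assumes "is_tree V E" "q \<in> V"
  obtains par rk where "rooted V q par rk" "E = rooted.edges V q par"
proof -
  define par where "par v = tree_path V E v q ! 1" for v
  define rk where "rk v = length (tree_path V E v q)" for v
  have uniq: "tree_path V E v q = xs" if "v \<in> V" "is_path V E v q xs" for v xs
    using tree_path_unique[OF assms(1) that(1) assms(2)] that(2)
      is_path_tree_path[OF assms(1) that(1) assms(2)] by blast
  have split: "\<exists>xs. tree_path V E v q = v # par v # xs \<and> tree_path V E (par v) q = par v # xs
      \<and> par v \<in> V \<and> {v, par v} \<in> E" if v: "v \<in> V" "v \<noteq> q" for v
  proof -
    have P: "is_path V E v q (tree_path V E v q)" using is_path_tree_path[OF assms(1) v(1) assms(2)] .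
    then obtain a xs where xs: "tree_path V E v q = v # a # xs"
      using v(2) by (cases "tree_path V E v q" rule: walk_edges.cases) (auto simp: is_path_def)
    have a: "a = par v" by (simp add: par_def xs)
    have "is_path V E (par v) q (par v # xs)" "par v \<in> V" "{v, par v} \<in> E"
      using P is_path_suffix[of V E v q "[v]" a xs] by (auto simp: xs a is_path_def)
    then show ?thesis using uniq xs a by metis
  qed
  have rooted: "rooted V q par rk"
  proof
    show "finite V" using assms(1) by (simp add: is_tree_def is_graph_def)
    show "q \<in> V" by fact
    fix v assume "v \<in> V" "v \<noteq> q"
    then show "par v \<in> V" "rk (par v) < rk v" using split[of v] by (auto simp: rk_def)
  qed
  have "E \<subseteq> rooted.edges V q par"
  proof
    fix e assume e: "e \<in> E"
    then have "\<exists>u\<in>V. \<exists>v\<in>V. u \<noteq> v \<and> e = {u, v}"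
      using assms(1) unfolding is_tree_def is_graph_def by blast
    then obtain u v where uv: "u \<in> V" "v \<in> V" "u \<noteq> v" "e = {u, v}" by blast
    \<comment> \<open>If the path from v to q runs through u, it must start with the edge from v to u; otherwise,
      prepending u to it gives the path from u to q.\<close>
    have P: "is_path V E v q (tree_path V E v q)"
      using is_path_tree_path[OF assms(1) uv(2) assms(2)] .
    have "(u = par v \<and> v \<noteq> q) \<or> (v = par u \<and> u \<noteq> q)"
    proof (cases "u \<in> set (tree_path V E v q)")
      case True
      then obtain as bs where s: "tree_path V E v q = as @ u # bs" by (meson split_list)
      have as: "as \<noteq> []" using s P uv(3) by (auto simp: is_path_def)
      then have "hd as = v" using s P by (auto simp: is_path_def)
      then have "v \<in> set as" using as by (metis hd_in_set)
      then have "v \<notin> set (u # bs)" using P s by (auto simp: is_path_def)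
      moreover have "is_path V E u q (u # bs)" using is_path_suffix P s by metis
      ultimately have "is_path V E v q (v # u # bs)"
        using is_path_Cons[of V E u q "u # bs" v] e uv by (simp add: insert_commute)
      then have t: "tree_path V E v q = v # u # bs" using uniq uv by blast
      have "v \<noteq> q"
      proof
        assume "v = q"
        then have "is_path V E v q [v]" using uv by (simp add: is_path_def)
        then show False using uniq[OF uv(2)] t by force
      qed
      then show ?thesis using t by (simp add: par_def)
    next
      case False
      then have "is_path V E u q (u # tree_path V E v q)"
        using is_path_Cons[OF P] e uv by simp
      then have t: "tree_path V E u q = u # tree_path V E v q" using uniq uv by blast
      have "q \<in> set (tree_path V E v q)" using P last_in_set by (fastforce simp: is_path_def)
      then have "u \<noteq> q" using False by auto
      moreover have "tree_path V E v q ! 0 = v"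
        using P by (cases "tree_path V E v q") (auto simp: is_path_def)
      ultimately show ?thesis using t by (simp add: par_def)
    qed
    then show "e \<in> rooted.edges V q par"
      unfolding rooted.edges_def[OF rooted] using uv by (auto simp: insert_commute)
  qed
  moreover have "rooted.edges V q par \<subseteq> E"
    unfolding rooted.edges_def[OF rooted] using split by auto
  ultimately show thesis using that rooted by blast
qed

lemma cost_rooted:
  fixes V :: "(real^2) set"
  assumes "rooted V q par rk" "is_norm N" "terminals n p q \<subseteq> V"
  shows "cost N w n p t q V (rooted.edges V q par)
    = (\<Sum>v\<in>V - {q}. w (rooted.load V q par n p t v) * N (v - par v))"
proof -
  interpret rooted V q par rk by fact
  show ?thesis
    unfolding cost_def edges_def sum.reindex[OF inj_on_edge] o_def
    using flow_edge[OF assms(3), of _ t] edge_length_doubleton[OF assms(2)]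
    by (intro sum.cong) (auto simp: edges_def)
qed

section \<open>Splitting a vertex\<close>

text \<open>The vertex \<open>s\<close> is replaced by an edge from \<open>z\<close> to \<open>y\<close>, where \<open>y\<close> inherits the parent of \<open>s\<close>, the
  children in \<open>B\<close> are attached to \<open>z\<close> and the other children to \<open>y\<close>. One of \<open>y\<close>, \<open>z\<close> is placed at the
  old position \<open>s\<close> and the other one at a new position \<open>s'\<close>. Leaving open which is which covers both
  perturbations that are needed: for \<open>z = s'\<close> the edges from \<open>B\<close> are moved to the new point, and for
  \<open>y = s'\<close> the outgoing edge and the edges from the children outside \<open>B\<close> are moved.\<close>

locale rooted_split = rooted +
  fixes s s' y z :: 'a and B :: "'a set"
  assumes s: "s \<in> V" "s \<noteq> q" and new: "s' \<notin> V" and yz: "{y, z} = {s, s'}"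
    and B: "B \<subseteq> children s"
begin

definition split_par :: "'a \<Rightarrow> 'a" where
  "split_par v = (if v = z then y else if v = y then par s else if v \<in> B then z
     else if par v = s then y else par v)"

text \<open>Doubling the ranks makes room for one more vertex directly above \<open>y\<close>.\<close>

definition split_rk :: "'a \<Rightarrow> nat" where
  "split_rk v = (if v = y then 2 * rk s else if v = z then 2 * rk s + 1 else 2 * rk v)"

lemma yz_cases: "y = s \<and> z = s' \<or> y = s' \<and> z = s" and yz_neq: "y \<noteq> z" "y \<noteq> q" "z \<noteq> q"
  using yz s new root_in by (auto simp: doubleton_eq_iff)

lemma in_old: "v \<in> V - {s} \<Longrightarrow> v \<noteq> y \<and> v \<noteq> z"
  using yz_cases new by auto

lemma par_s: "par s \<in> V - {s}" using par_in[OF s] rk_par[OF s] by auto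

lemma split_V: "insert s' V = (V - {s}) \<union> {y, z}"
  using yz s by auto

lemma split_par_old:
  assumes "v \<in> V - {s}" "v \<noteq> q"
  shows "split_par v = (if v \<in> B then z else if par v = s then y else par v)"
  using in_old[OF assms(1)] by (simp add: split_par_def)

lemma split_rk_old: "v \<in> V - {s} \<Longrightarrow> split_rk v = 2 * rk v"
  using in_old[of v] by (simp add: split_rk_def)

lemma B_in: "b \<in> B \<Longrightarrow> b \<in> V - {s} \<and> b \<noteq> q \<and> par b = s"
  using B rk_par[of b] by (auto simp: children_def)

sublocale new: rooted "insert s' V" q split_par split_rk
proof
  show "finite (insert s' V)" "q \<in> insert s' V" using finite_V root_in by auto
  fix v assume v: "v \<in> insert s' V" "v \<noteq> q"
  consider "v = y" | "v = z" | "v \<in> V - {s}" using v split_V by auto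
  then have "split_par v \<in> insert s' V \<and> split_rk (split_par v) < split_rk v"
  proof cases
    case 1
    then show ?thesis
      using par_s split_rk_old[OF par_s] rk_par[OF s] yz_neq by (simp add: split_par_def split_rk_def)
  next
    case 2
    then show ?thesis using split_V yz_neq by (simp add: split_par_def split_rk_def)
  next
    case 3
    have "rk (par v) < rk v" "par v \<in> V" using rk_par[of v] par_in[of v] 3 v(2) by auto
    then show ?thesis
      using split_V yz_neq B_in[of v] split_rk_old[of "par v"] split_rk_old[OF 3] split_par_old[OF 3 v(2)]
      by (auto simp: split_rk_def[of y] split_rk_def[of z])
  qed
  then show "split_par v \<in> insert s' V" "split_rk (split_par v) < split_rk v" by auto
qed

text \<open>Contracting the edge from \<open>z\<close> to \<open>y\<close> undoes the split.\<close>

lemma split_reach_imp: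
  assumes "(u, v) \<in> new.arcs\<^sup>*" "u \<in> V - {s}"
  shows "(u, if v \<in> {y, z} then s else v) \<in> arcs\<^sup>*"
  using assms(1)
proof (induction rule: rtrancl_induct)
  case base
  then show ?case using in_old[OF assms(2)] by auto
next
  case (step v v')
  then have v: "v \<in> insert s' V" "v \<noteq> q" "v' = split_par v" by (auto simp: new.arcs_def)
  consider "v = y" | "v = z" | "v \<in> V - {s}" using v split_V by auto
  then show ?case
  proof cases
    case 1
    then have "v' = par s" using v yz_neq by (simp add: split_par_def)
    then show ?thesis using step.IH 1 par_s in_old[OF par_s] arcsI[OF s]
      by (auto intro: rtrancl_into_rtrancl)
  next
    case 2
    then show ?thesis using step.IH v yz_neq by (simp add: split_par_def)
  next
    case 3
    have "(if v' \<in> {y, z} then s else v') = par v"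
      using split_par_old[OF 3 v(2)] v(3) B_in[of v] in_old[of "par v"] par_in[of v] 3 v(2) by auto
    then show ?thesis using step.IH in_old[OF 3] 3 v(2) arcsI[of v]
      by (auto intro: rtrancl_into_rtrancl)
  qed
qed

text \<open>Conversely, a path lifts to the split tree: where it passes through \<open>s\<close>, it is led through \<open>y\<close>,
  with a detour over \<open>z\<close> if it arrives from \<open>B\<close>.\<close>

lemma split_reach_old:
  assumes "(u, v) \<in> arcs\<^sup>*" "u \<in> V - {s}"
  shows "(u, if v = s then y else v) \<in> new.arcs\<^sup>*"
  using assms(1)
proof (induction rule: rtrancl_induct)
  case base
  then show ?case using assms(2) by auto
next
  case (step v v')
  then have v: "v \<in> V" "v \<noteq> q" "v' = par v" by (auto simp: arcs_def)
  show ?case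
  proof (cases "v = s")
    case True
    have "(y, split_par y) \<in> new.arcs" using yz_neq yz s by (intro new.arcsI) auto
    moreover have "split_par y = par s" using yz_neq by (simp add: split_par_def)
    ultimately show ?thesis using step.IH True v par_s by (auto intro: rtrancl_into_rtrancl)
  next
    case False
    then have v3: "v \<in> V - {s}" using v by auto
    have e: "(v, split_par v) \<in> new.arcs" using v by (intro new.arcsI) auto
    have z: "(z, split_par z) \<in> new.arcs" using yz_neq yz s by (intro new.arcsI) auto
    have IH: "(u, v) \<in> new.arcs\<^sup>*" using step.IH False by simp
    show ?thesis
    proof (cases "v \<in> B")
      case True
      then have "split_par v = z" "v' = s" using split_par_old[OF v3 v(2)] B_in v by auto
      then have "(u, z) \<in> new.arcs\<^sup>*" using IH e by (auto intro: rtrancl_into_rtrancl)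
      then have "(u, y) \<in> new.arcs\<^sup>*" using z by (auto simp: split_par_def intro: rtrancl_into_rtrancl)
      then show ?thesis using \<open>v' = s\<close> by simp
    next
      case False
      then have "split_par v = (if v' = s then y else v')" using split_par_old[OF v3 v(2)] v by auto
      then show ?thesis using IH e by (auto intro: rtrancl_into_rtrancl)
    qed
  qed
qed

lemma split_reach:
  assumes "u \<in> V - {s}" "v \<in> V - {s}"
  shows "(u, v) \<in> new.arcs\<^sup>* \<longleftrightarrow> (u, v) \<in> arcs\<^sup>*"
  using split_reach_imp[OF _ assms(1), of v] split_reach_old[OF _ assms(1), of v] in_old[OF assms(2)] assms(2)
  by auto

lemma split_reach_y:
  assumes "u \<in> V - {s}"
  shows "(u, y) \<in> new.arcs\<^sup>* \<longleftrightarrow> (u, s) \<in> arcs\<^sup>*"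
  using split_reach_imp[OF _ assms(1), of y] split_reach_old[OF _ assms(1), of s] by auto

lemma split_reach_z:
  assumes "u \<in> V - {s}"
  shows "(u, z) \<in> new.arcs\<^sup>* \<longleftrightarrow> (\<exists>b\<in>B. (u, b) \<in> arcs\<^sup>*)"
proof -
  have "new.children z = B"
  proof -
    have "v \<in> new.children z \<longleftrightarrow> v \<in> B" for v
    proof -
      consider "v = y" | "v = z" | "v \<in> V - {s}" | "v \<notin> insert s' V" using split_V by auto
      then show ?thesis
      proof cases
        case 1
        then show ?thesis
          using yz_neq in_old[OF par_s] B_in[of v] in_old[of v] by (auto simp: new.children_def split_par_def)
      next
        case 2
        then show ?thesis
          using yz_neq B_in[of v] in_old[of v] by (auto simp: new.children_def split_par_def)
      next
        case 3
        then show ?thesis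
          using yz_neq B_in[of v] split_par_old[of v] in_old[of "par v"] par_in[of v]
          by (cases "par v = s") (auto simp: new.children_def split: if_splits)
      next
        case 4
        then show ?thesis using B_in[of v] by (auto simp: new.children_def)
      qed
    qed
    then show ?thesis by blast
  qed
  moreover have "u \<noteq> z" "u \<in> insert s' V" using in_old[OF assms] assms by auto
  ultimately have "(u, z) \<in> new.arcs\<^sup>* \<longleftrightarrow> (\<exists>b\<in>B. (u, b) \<in> new.arcs\<^sup>*)"
    using new.reach_children[of u z] by simp
  then show ?thesis using split_reach[OF assms] B_in by blast
qed

lemma split_arborescence:
  assumes g: "gilbert_arborescence n p q V edges" and st: "s \<notin> terminals n p q" and ne: "B \<noteq> {}"
  shows "gilbert_arborescence n p q (insert s' V) new.edges"
proof -
  have T: "terminals n p q \<subseteq> V" and used: "\<And>v. v \<in> V - {q} \<Longrightarrow> \<exists>i\<in>{1..n}. (p i, v) \<in> arcs\<^sup>*"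
    using g gilbert_arborescence_edges by auto
  have p: "p i \<in> V - {s}" if "i \<in> {1..n}" for i using T st that by (auto simp: terminals_def)
  have "\<exists>i\<in>{1..n}. (p i, v) \<in> new.arcs\<^sup>*" if v: "v \<in> insert s' V - {q}" for v
  proof -
    consider "v = y" | "v = z" | "v \<in> V - {s}" using v split_V by auto
    then show ?thesis
    proof cases
      case 1
      then show ?thesis using split_reach_y[OF p] used[of s] s by blast
    next
      case 2
      then show ?thesis using split_reach_z[OF p] ne used B_in by blast
    next
      case 3
      then show ?thesis using split_reach[OF p] used v by blast
    qed
  qed
  then show ?thesis using T new.gilbert_arborescence_edges by auto
qed

lemma split_load:
  assumes T: "terminals n p q \<subseteq> V - {s}"
  shows "v \<in> V - {s} \<Longrightarrow> new.load n p t v = load n p t v"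
    and "new.load n p t y = load n p t s"
    and "new.load n p t z = (\<Sum>b\<in>B. load n p t b)"
proof -
  have p: "p i \<in> V - {s}" if "i \<in> {1..n}" for i using T that unfolding terminals_def by blast
  show "new.load n p t v = load n p t v" if "v \<in> V - {s}"
    unfolding new.load_def load_def using split_reach[OF p that] by (metis (mono_tags, lifting))
  show "new.load n p t y = load n p t s"
    unfolding new.load_def load_def using split_reach_y[OF p] by (metis (mono_tags, lifting))
  have "{i \<in> {1..n}. (p i, z) \<in> new.arcs\<^sup>*} = (\<Union>b\<in>B. {i \<in> {1..n}. (p i, b) \<in> arcs\<^sup>*})"
    using split_reach_z[OF p] by auto
  moreover have "finite B" using B finite_V by (meson B_in DiffD1 finite_subset subsetI)
  moreover have "\<forall>a\<in>B. \<forall>b\<in>B. a \<noteq> b \<longrightarrow>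
      {i \<in> {1..n}. (p i, a) \<in> arcs\<^sup>*} \<inter> {i \<in> {1..n}. (p i, b) \<in> arcs\<^sup>*} = {}"
    using B siblings_disjoint[of _ s] by blast
  ultimately show "new.load n p t z = (\<Sum>b\<in>B. load n p t b)"
    unfolding new.load_def load_def by (simp add: sum.UNION_disjoint)
qed

end

section \<open>Norming functionals of a smooth norm\<close>

lemma is_norm_minus: "is_norm N \<Longrightarrow> N (- x) = N x"
proof -
  assume "is_norm N"
  then have "N ((-1) *\<^sub>R x) = \<bar>-1\<bar> * N x" unfolding is_norm_def by blast
  then show ?thesis by simp
qed

text \<open>The derivative at \<open>x\<close>, represented by a vector through the inner product.\<close>

definition gradient :: "(real^2 \<Rightarrow> real) \<Rightarrow> real^2 \<Rightarrow> real^2" where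
  "gradient N x = (\<Sum>b\<in>Basis. frechet_derivative N (at x) b *\<^sub>R b)"

lemma has_derivative_gradient:
  assumes "N differentiable (at x)"
  shows "(N has_derivative (\<lambda>u. gradient N x \<bullet> u)) (at x)"
proof -
  let ?D = "frechet_derivative N (at x)"
  have D: "(N has_derivative ?D) (at x)" using assms frechet_derivative_works by blast
  then have lin: "linear ?D" by (rule has_derivative_linear)
  have "?D u = gradient N x \<bullet> u" for u
  proof -
    have "?D u = ?D (\<Sum>b\<in>Basis. (u \<bullet> b) *\<^sub>R b)" by (simp add: euclidean_representation)
    also have "\<dots> = (\<Sum>b\<in>Basis. (u \<bullet> b) * ?D b)"
      by (simp add: linear_sum[OF lin] linear_scale[OF lin])
    also have "\<dots> = gradient N x \<bullet> u"
      by (simp add: gradient_def inner_sum_left inner_commute[of u] mult.commute)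
    finally show ?thesis .
  qed
  then have "?D = (\<lambda>u. gradient N x \<bullet> u)" by (rule ext)
  then show ?thesis using D by metis
qed

text \<open>This is where smoothness enters: under the hypotheses, \<open>c N - g\<close> has a minimum at \<open>x\<close>, so its
  derivative vanishes there.\<close>

lemma norming_functional_unique:
  assumes diff: "N differentiable (at x)"
    and le: "\<And>u. g \<bullet> u \<le> c * N u" and eq: "g \<bullet> x = c * N x"
  shows "g = c *\<^sub>R gradient N x"
proof -
  let ?f = "\<lambda>u. c * N u - g \<bullet> u"
  have "(?f has_derivative (\<lambda>u. c * (gradient N x \<bullet> u) - g \<bullet> u)) (at x)"
    using has_derivative_gradient[OF diff] by (auto intro!: derivative_eq_intros)
  moreover have "?f x \<le> ?f y" for y using le[of y] eq by simp
  ultimately have "(\<lambda>u. c * (gradient N x \<bullet> u) - g \<bullet> u) = (\<lambda>v. 0)"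
    by (intro differential_zero_maxmin[of x UNIV ?f]) auto
  then have "(c *\<^sub>R gradient N x - g) \<bullet> u = 0" for u
    by (simp add: inner_diff_left fun_eq_iff)
  then have "c *\<^sub>R gradient N x - g = 0" by (metis inner_eq_zero_iff)
  then show ?thesis by simp
qed

lemma has_real_derivative_along:
  assumes "N differentiable (at x)"
  shows "((\<lambda>e. N (x - e *\<^sub>R u)) has_real_derivative - (gradient N x \<bullet> u)) (at 0)"
proof -
  have g: "((\<lambda>e::real. x - e *\<^sub>R u) has_derivative (\<lambda>e. - (e *\<^sub>R u))) (at 0)"
    by (auto intro!: derivative_eq_intros)
  have N: "(N has_derivative (\<lambda>u. gradient N x \<bullet> u)) (at (x - 0 *\<^sub>R u))"
    using has_derivative_gradient[OF assms] by simp
  have "((\<lambda>e. N (x - e *\<^sub>R u)) has_derivative (\<lambda>e. gradient N x \<bullet> (- (e *\<^sub>R u)))) (at 0)"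
    using diff_chain_at[OF g N] unfolding o_def .
  then show ?thesis unfolding has_field_derivative_def
    by (rule has_derivative_eq_rhs) (auto simp: fun_eq_iff mult.commute)
qed

lemma gradient_le:
  assumes "smooth_norm N" "x \<noteq> 0"
  shows "gradient N x \<bullet> u \<le> N u"
proof (rule ccontr)
  assume "\<not> ?thesis"
  let ?f = "\<lambda>e. N (x - e *\<^sub>R u) + e * N u"
  have nd: "is_norm N" "N differentiable (at x)" using assms by (auto simp: smooth_norm_def)
  have "(?f has_real_derivative - (gradient N x \<bullet> u) + N u) (at 0)"
    using has_real_derivative_along[OF nd(2)] by (auto intro!: derivative_eq_intros)
  from has_real_derivative_neg_dec_right[OF this] \<open>\<not> ?thesis\<close>
  obtain e where e: "e > 0" "\<And>k. 0 < k \<Longrightarrow> k < e \<Longrightarrow> ?f k < ?f 0" by auto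
  let ?k = "e / 2"
  have "N ((x - ?k *\<^sub>R u) + ?k *\<^sub>R u) \<le> N (x - ?k *\<^sub>R u) + N (?k *\<^sub>R u)"
    using nd unfolding is_norm_def by blast
  moreover have "N (?k *\<^sub>R u) = \<bar>?k\<bar> * N u" using nd unfolding is_norm_def by blast
  ultimately show False using e(2)[of ?k] e(1) by simp
qed

lemma gradient_self:
  assumes "smooth_norm N" "x \<noteq> 0"
  shows "gradient N x \<bullet> x = N x"
proof -
  have nd: "is_norm N" "N differentiable (at x)" using assms by (auto simp: smooth_norm_def)
  have "N (x - e *\<^sub>R x) = \<bar>1 - e\<bar> * N x" for e
  proof -
    have "N ((1 - e) *\<^sub>R x) = \<bar>1 - e\<bar> * N x" using nd unfolding is_norm_def by blast
    then show ?thesis by (simp add: algebra_simps)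
  qed
  then have "((\<lambda>e. \<bar>1 - e\<bar> * N x) has_real_derivative - (gradient N x \<bullet> x)) (at 0)"
    using has_real_derivative_along[OF nd(2), of x] by simp
  moreover have "((\<lambda>e. (1 - e) * N x) has_real_derivative - N x) (at 0)"
    by (auto intro!: derivative_eq_intros)
  then have "((\<lambda>e. \<bar>1 - e\<bar> * N x) has_real_derivative - N x) (at 0)"
    by (rule has_field_derivative_transform_within[where d = 1]) (auto simp: dist_real_def)
  ultimately show ?thesis using DERIV_unique by fastforce
qed

definition cross :: "real^2 \<Rightarrow> real^2 \<Rightarrow> real" where
  "cross x y = x $ 1 * y $ 2 - x $ 2 * y $ 1"

lemma cross_decomposition:
  assumes "cross a b \<noteq> 0"
  shows "c = (cross c b / cross a b) *\<^sub>R a + (cross a c / cross a b) *\<^sub>R b"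
proof -
  have 1: "c $ 1 * cross a b = cross c b * a $ 1 + cross a c * b $ 1"
    and 2: "c $ 2 * cross a b = cross c b * a $ 2 + cross a c * b $ 2"
    by (simp_all add: cross_def algebra_simps)
  show ?thesis using assms 1 2 by (simp add: vec_eq_iff forall_2 field_simps)
qed

lemma cross_0_parallel:
  assumes "cross a b = 0" "a \<noteq> 0"
  obtains r where "b = r *\<^sub>R a"
proof (cases "a $ 1 = 0")
  case True
  then have "a $ 2 \<noteq> 0" using assms(2) by (auto simp: vec_eq_iff forall_2)
  then have "b = (b $ 2 / a $ 2) *\<^sub>R a" using assms(1) True
    by (simp add: vec_eq_iff forall_2 cross_def)
  then show ?thesis using that by blast
next
  case False
  then have "b = (b $ 1 / a $ 1) *\<^sub>R a" using assms(1)
    by (simp add: vec_eq_iff forall_2 cross_def field_simps)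
  then show ?thesis using that by blast
qed

text \<open>All gradients of a norm are unit vectors of the dual norm; hence this bound, and its mirror image
  after exchanging \<open>x\<close> and \<open>y\<close>.\<close>

lemma gradient_parallel:
  assumes "smooth_norm N" "x \<noteq> 0" "y \<noteq> 0" "gradient N y = r *\<^sub>R gradient N x"
  shows "\<bar>r\<bar> \<ge> 1"
proof -
  have N: "is_norm N" using assms by (simp add: smooth_norm_def)
  have pos: "N y > 0" using N assms(3) unfolding is_norm_def by (metis order_le_less)
  have "gradient N x \<bullet> (- y) \<le> N y" "gradient N x \<bullet> y \<le> N y"
    using gradient_le[OF assms(1,2)] is_norm_minus[OF N] by metis+
  then have "\<bar>gradient N x \<bullet> y\<bar> \<le> N y" by (simp add: abs_le_iff)
  then have "\<bar>r\<bar> * \<bar>gradient N x \<bullet> y\<bar> \<le> \<bar>r\<bar> * N y" by (rule mult_left_mono) simp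
  moreover have "N y = r * (gradient N x \<bullet> y)"
    using gradient_self[OF assms(1,3)] assms(4) by simp
  then have "N y \<le> \<bar>r\<bar> * \<bar>gradient N x \<bullet> y\<bar>" by (metis abs_ge_self abs_mult)
  ultimately have "1 * N y \<le> \<bar>r\<bar> * N y" by simp
  then show ?thesis using pos by (simp only: mult_le_cancel_right_pos)
qed

section \<open>At most two incoming functionals\<close>

text \<open>The first-order conditions at a vertex: \<open>a\<close> points along the outgoing edge, which carries flow
  \<open>M\<close>, and \<open>f c\<close> points along the incoming edge \<open>c\<close>, which carries flow \<open>m c\<close>.\<close>

locale split_conditions =
  fixes N :: "real^2 \<Rightarrow> real" and d h M :: real and a :: "real^2"
    and C :: "'c set" and f :: "'c \<Rightarrow> real^2" and m :: "'c \<Rightarrow> real"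
  assumes smooth: "smooth_norm N" and d: "d > 0" and h: "h \<ge> 0"
    and a: "a \<noteq> 0" and f: "\<And>c. c \<in> C \<Longrightarrow> f c \<noteq> 0" and m: "\<And>c. c \<in> C \<Longrightarrow> m c \<ge> 0"
    and M: "M \<ge> 0"
    and split_pair: "\<And>j k u. j \<in> C \<Longrightarrow> k \<in> C \<Longrightarrow> j \<noteq> k \<Longrightarrow>
      ((d + h * m j) *\<^sub>R gradient N (f j) + (d + h * m k) *\<^sub>R gradient N (f k)) \<bullet> u
        \<le> (d + h * (m j + m k)) * N u"
    and split_out: "\<And>k u. k \<in> C \<Longrightarrow>
      ((d + h * M) *\<^sub>R gradient N a + (d + h * m k) *\<^sub>R gradient N (f k)) \<bullet> u
        \<le> (d + h * (M - m k)) * N u"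
begin

lemma norm_N: "is_norm N" using smooth by (simp add: smooth_norm_def)

lemma diff_N: "x \<noteq> 0 \<Longrightarrow> N differentiable (at x)" using smooth by (simp add: smooth_norm_def)

lemma N_pos: "x \<noteq> 0 \<Longrightarrow> N x > 0" 
  using norm_N unfolding is_norm_def by (metis order_le_less)

abbreviation "g0 \<equiv> gradient N a"
abbreviation "g c \<equiv> gradient N (f c)"

lemma wpos: "c \<in> C \<Longrightarrow> d + h * m c > 0" "d + h * M > 0"
  using d h m M by (simp_all add: add_pos_nonneg)

text \<open>Otherwise \<open>split_out\<close> would bound \<open>2 d + h (M + m k)\<close> by \<open>d + h (M - m k)\<close>.\<close>

lemma not_parallel_out:
  assumes "k \<in> C" shows "g k \<noteq> g0"
proof
  assume "g k = g0"
  then have "(d + h * M) * N a + (d + h * m k) * N a \<le> (d + h * (M - m k)) * N a"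
    using split_out[OF assms, of a] gradient_self[OF smooth a] by (simp add: inner_add_left)
  then have "(d + 2 * h * m k) * N a \<le> 0" by (simp add: algebra_simps)
  moreover have "d + 2 * h * m k > 0" using d h m[OF assms] by (simp add: add_pos_nonneg)
  ultimately show False using N_pos[OF a] by (simp add: mult_le_0_iff)
qed

lemma sum_functional_eq:
  assumes jk: "j \<in> C" "k \<in> C" "j \<noteq> k" and x: "x \<noteq> 0"
    and eq: "((d + h * m j) *\<^sub>R g j + (d + h * m k) *\<^sub>R g k) \<bullet> x \<ge> (d + h * (m j + m k)) * N x"
  shows "(d + h * m j) *\<^sub>R g j + (d + h * m k) *\<^sub>R g k = (d + h * (m j + m k)) *\<^sub>R gradient N x"
  using split_pair[OF jk] eq
  by (intro norming_functional_unique[OF diff_N[OF x]]) (auto intro: antisym)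

text \<open>If \<open>\<phi>\<^sub>j = -\<phi>\<^sub>0\<close>, the two bounds for \<open>k\<close> add up to an equality at \<open>f j\<close>. So \<open>x\<^sub>j + x\<^sub>k\<close> attains its
  norm at \<open>f j\<close>, which makes \<open>x\<^sub>k\<close> a multiple of \<open>\<phi>\<^sub>j\<close>, and one that is too short since \<open>d > 0\<close>.\<close>

lemma not_opposite_out:
  assumes jk: "j \<in> C" "k \<in> C" "j \<noteq> k" shows "g j \<noteq> - g0"
proof
  assume opp: "g j = - g0"
  let ?x = "f j"
  have gx: "g j \<bullet> ?x = N ?x" "g0 \<bullet> ?x = - N ?x"
    using gradient_self[OF smooth f[OF jk(1)]] opp by auto
  have "((d + h * M) *\<^sub>R g0 + (d + h * m k) *\<^sub>R g k) \<bullet> (- ?x) \<le> (d + h * (M - m k)) * N ?x"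
    using split_out[OF jk(2), of "- ?x"] is_norm_minus[OF norm_N] by simp
  then have "((d + h * m j) *\<^sub>R g j + (d + h * m k) *\<^sub>R g k) \<bullet> ?x \<ge> (d + h * (m j + m k)) * N ?x"
    using gx by (simp add: inner_add_left algebra_simps)
  from sum_functional_eq[OF jk f[OF jk(1)] this]
  have "(d + h * m k) *\<^sub>R g k = (h * m k) *\<^sub>R g j"
    by (simp add: algebra_simps)
  then have "g k = (h * m k / (d + h * m k)) *\<^sub>R g j"
    using wpos(1)[OF jk(2)] by (simp add: eq_vector_fraction_iff)
  from gradient_parallel[OF smooth f[OF jk(1)] f[OF jk(2)] this]
  show False using wpos(1)[OF jk(2)] d h m[OF jk(2)] by (simp add: field_simps)
qed

text \<open>The crossing diagonals of the quadrilateral. With \<open>X = x\<^sub>0\<close>, \<open>Y = x\<^sub>j\<close>, \<open>Z = x\<^sub>k = A X + B Y\<close>, the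
  diagonals are \<open>P = -(X + Z)\<close> and \<open>Q = Y + Z\<close>, and the crossing point divides both of them so that
  \<open>-X\<close> and \<open>Y\<close> are nonnegative combinations of \<open>P\<close> and \<open>Q\<close>. Evaluating the first at \<open>-a\<close> and the
  second at \<open>f j\<close>, where their norms are attained, leaves no slack in the bounds for \<open>P\<close> and \<open>Q\<close>.
  The coefficients of \<open>Q\<close> are positive in both, so \<open>Q\<close> attains its norm at \<open>-a\<close> as well as at \<open>f j\<close>.\<close>

lemma not_between:
  assumes jk: "j \<in> C" "k \<in> C" "j \<noteq> k" and "\<alpha> \<ge> 0" "\<beta> > 0"
  shows "g k \<noteq> \<alpha> *\<^sub>R g0 + \<beta> *\<^sub>R g j"
proof
  assume gk: "g k = \<alpha> *\<^sub>R g0 + \<beta> *\<^sub>R g j"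
  let ?w0 = "d + h * M" and ?wj = "d + h * m j" and ?wk = "d + h * m k"
  let ?p = "d + h * (M - m k)" and ?q = "d + h * (m j + m k)"
  define X Y Z where "X = ?w0 *\<^sub>R g0" and "Y = ?wj *\<^sub>R g j" and "Z = ?wk *\<^sub>R g k"
  define A B where "A = ?wk * \<alpha> / ?w0" and "B = ?wk * \<beta> / ?wj"
  have A: "A \<ge> 0" and B: "B > 0"
    using assms wpos(1)[OF jk(1)] wpos(1)[OF jk(2)] wpos(2) by (simp_all add: A_def B_def)
  have Z: "Z = A *\<^sub>R X + B *\<^sub>R Y"
    using wpos(1)[OF jk(1)] wpos(2) by (simp add: X_def Y_def Z_def A_def B_def gk scaleR_right_distrib)
  define P Q where "P = - (X + Z)" and "Q = Y + Z"
  have P: "P \<bullet> u \<le> ?p * N u" for u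
    using split_out[OF jk(2), of "- u"] is_norm_minus[OF norm_N]
    by (simp add: P_def X_def Z_def inner_diff_left inner_add_left algebra_simps)
  have Q: "Q \<bullet> u \<le> ?q * N u" for u
    using split_pair[OF jk, of u] by (simp add: Q_def Y_def Z_def)
  have X_eq: "B *\<^sub>R Q + (1 + B) *\<^sub>R P = - ((1 + A + B) *\<^sub>R X)"
    by (simp add: P_def Q_def Z algebra_simps)
  have Y_eq: "(1 + A) *\<^sub>R Q + A *\<^sub>R P = (1 + A + B) *\<^sub>R Y"
    by (simp add: P_def Q_def Z algebra_simps)
  have 1: "B * (Q \<bullet> (- a)) + (1 + B) * (P \<bullet> (- a)) = (1 + A + B) * ?w0 * N a"
  proof -
    have "(B *\<^sub>R Q + (1 + B) *\<^sub>R P) \<bullet> (- a) = (1 + A + B) * ?w0 * N a"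
      unfolding X_eq using gradient_self[OF smooth a] by (simp add: X_def)
    then show ?thesis by (simp only: inner_add_left inner_scaleR_left)
  qed
  have 2: "(1 + A) * (Q \<bullet> f j) + A * (P \<bullet> f j) = (1 + A + B) * ?wj * N (f j)"
  proof -
    have "((1 + A) *\<^sub>R Q + A *\<^sub>R P) \<bullet> f j = (1 + A + B) * ?wj * N (f j)"
      unfolding Y_eq using gradient_self[OF smooth f[OF jk(1)]] by (simp add: Y_def)
    then show ?thesis by (simp only: inner_add_left inner_scaleR_left)
  qed
  \<comment> \<open>Normalised values of Q at the two points; the bounds leave only the value ?q for both.\<close>
  define x y where "x = Q \<bullet> (- a) / N a" and "y = Q \<bullet> f j / N (f j)"
  have xq: "x \<le> ?q" and yq: "y \<le> ?q"
    using Q[of "- a"] Q[of "f j"] N_pos[OF a] N_pos[OF f[OF jk(1)]] is_norm_minus[OF norm_N]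
    by (simp_all only: x_def y_def pos_divide_le_eq)
  have xa: "Q \<bullet> (- a) = x * N a" and yf: "Q \<bullet> f j = y * N (f j)"
    using N_pos[OF a] N_pos[OF f[OF jk(1)]] by (simp_all add: x_def y_def)
  have "(1 + A + B) * ?w0 \<le> B * x + (1 + B) * ?p"
  proof -
    have "(1 + B) * (P \<bullet> (- a)) \<le> (1 + B) * (?p * N a)"
      using P[of "- a"] B is_norm_minus[OF norm_N] by (intro mult_left_mono) auto
    then have "(1 + A + B) * ?w0 * N a \<le> (B * x + (1 + B) * ?p) * N a"
      using 1 unfolding xa by (simp only: distrib_right mult.assoc)
    then show ?thesis using N_pos[OF a] by (simp only: mult_le_cancel_right_pos)
  qed
  moreover have "(1 + A + B) * ?wj \<le> (1 + A) * y + A * ?p"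
  proof -
    have "A * (P \<bullet> f j) \<le> A * (?p * N (f j))"
      using P[of "f j"] A by (intro mult_left_mono) auto
    then have "(1 + A + B) * ?wj * N (f j) \<le> ((1 + A) * y + A * ?p) * N (f j)"
      using 2 unfolding yf by (simp only: distrib_right mult.assoc)
    then show ?thesis using N_pos[OF f[OF jk(1)]] by (simp only: mult_le_cancel_right_pos)
  qed
  moreover have "?w0 + ?wj = ?p + ?q" by (simp add: algebra_simps)
  ultimately have key: "(1 + A + B) * (?p + ?q) \<le> B * x + (1 + A) * y + (1 + A + B) * ?p"
    by (smt (verit) distrib_left distrib_right)
  have "B * (?q - x) + (1 + A) * (?q - y) \<le> 0"
    using key by (simp add: algebra_simps)
  moreover have "B * (?q - x) \<ge> 0" "(1 + A) * (?q - y) \<ge> 0"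
    using A B xq yq by auto
  ultimately have "B * (?q - x) = 0" "(1 + A) * (?q - y) = 0" by linarith+
  then have "x = ?q" "y = ?q" using A B by auto
  then have eqs: "Q \<bullet> (- a) = ?q * N (- a)" "Q \<bullet> f j = ?q * N (f j)"
    using xa yf is_norm_minus[OF norm_N] by simp_all
  have "- Q = ?q *\<^sub>R g0"
    using eqs(1) Q[of "- _"] is_norm_minus[OF norm_N]
    by (intro norming_functional_unique[OF diff_N[OF a]]) auto
  then have "Q = ?q *\<^sub>R (- g0)" by (metis minus_minus scaleR_minus_right)
  moreover have "Q = ?q *\<^sub>R g j"
    using norming_functional_unique[OF diff_N[OF f[OF jk(1)]] Q eqs(2)] .
  ultimately have "?q *\<^sub>R (g j) = ?q *\<^sub>R (- g0)" by simp
  moreover have "?q > 0" using d h m[OF jk(1)] m[OF jk(2)] by (simp add: add_pos_nonneg)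
  ultimately have "g j = - g0" by (metis less_irrefl scaleR_cancel_left)
  then show False using not_opposite_out[OF jk] by simp
qed

text \<open>Of two vectors on the same side of the line spanned by \<open>\<phi>\<^sub>0\<close>, the one at the smaller angle to \<open>\<phi>\<^sub>0\<close>
  lies in the cone spanned by \<open>\<phi>\<^sub>0\<close> and the other one. The sign of the cross product of the two tells
  which one it is.\<close>

lemma same_side_impossible:
  assumes jk: "j \<in> C" "k \<in> C" "j \<noteq> k" and "cross g0 (g j) * cross g0 (g k) > 0"
  shows False
proof -
  let ?s = "cross g0 (g j)" and ?t = "cross g0 (g k)"
  have nz: "?s \<noteq> 0" "?t \<noteq> 0" and q: "?t / ?s > 0" "?s / ?t > 0"
    using assms(4) by (auto simp: zero_less_mult_iff zero_less_divide_iff)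
  have 1: "\<not> cross (g k) (g j) / ?s \<ge> 0"
    using not_between[OF jk _ q(1)] cross_decomposition[OF nz(1), of "g k"] by blast
  have 2: "\<not> cross (g j) (g k) / ?t \<ge> 0"
    using not_between[OF jk(2,1) jk(3)[symmetric] _ q(2)] cross_decomposition[OF nz(2), of "g j"] by blast
  have "cross (g j) (g k) = - cross (g k) (g j)" by (simp add: cross_def)
  then have "cross (g k) (g j) / ?s < 0" "cross (g k) (g j) / ?t > 0" using 1 2 by simp_all
  then show False using assms(4)
    by (auto simp: zero_less_divide_iff divide_less_0_iff zero_less_mult_iff)
qed

lemma at_most_two_in:
  shows "card C \<le> 2"
proof (rule ccontr)
  assume "\<not> ?thesis"
  then have "3 \<le> card C" by simp
  then obtain S where "S \<subseteq> C" "card S = 3" by (meson obtain_subset_with_card_n)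
  then obtain x y z where xyz: "x \<in> C" "y \<in> C" "z \<in> C" "x \<noteq> y" "x \<noteq> z" "y \<noteq> z"
    by (auto simp: card_Suc_eq numeral_3_eq_3)
  have nz: "cross g0 (g c) \<noteq> 0" if "c \<in> C" for c
  proof
    assume "cross g0 (g c) = 0"
    moreover have g0: "g0 \<noteq> 0" using gradient_self[OF smooth a] N_pos[OF a] by auto
    ultimately obtain r where r: "g c = r *\<^sub>R g0" using cross_0_parallel by blast
    have "\<bar>r\<bar> \<ge> 1" using gradient_parallel[OF smooth a f[OF that] r] .
    moreover from this have "g0 = (1 / r) *\<^sub>R g c" using r by auto
    from gradient_parallel[OF smooth f[OF that] a this] have "\<bar>1 / r\<bar> \<ge> 1" .
    ultimately have "\<bar>r\<bar> = 1" by (simp add: le_divide_eq split: if_splits)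
    then have "g c = g0 \<or> g c = - g0" using r by (auto simp: abs_if split: if_splits)
    moreover obtain k where "k \<in> C" "c \<noteq> k" using xyz by metis
    ultimately show False using not_parallel_out[OF that] not_opposite_out[OF that] by blast
  qed
  have "cross g0 (g x) * cross g0 (g y) > 0 \<or> cross g0 (g x) * cross g0 (g z) > 0
      \<or> cross g0 (g y) * cross g0 (g z) > 0"
    using nz[OF xyz(1)] nz[OF xyz(2)] nz[OF xyz(3)] by (auto simp: zero_less_mult_iff)
  then show False using same_side_impossible xyz by blast
qed

end

section \<open>Steiner points of minimum arborescences\<close>

text \<open>Moving the common end of two edges by \<open>e u\<close> and paying for the connection to the old position.
  Since \<open>V\<close> is finite, there are arbitrarily small \<open>e > 0\<close> for which the new position avoids \<open>V\<close>, and
  one such \<open>e\<close> contradicts a negative right derivative of the cost at 0.\<close>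

lemma two_edges_first_variation:
  assumes N: "smooth_norm N" and x: "x \<noteq> 0" and y: "y \<noteq> 0" and fin: "finite V"
    and min: "\<And>e. e > 0 \<Longrightarrow> s + e *\<^sub>R u \<notin> V \<Longrightarrow>
      \<alpha> * N x + \<beta> * N y \<le> \<alpha> * N (x - e *\<^sub>R u) + \<beta> * N (y - e *\<^sub>R u) + \<gamma> * N (e *\<^sub>R u)"
  shows "(\<alpha> *\<^sub>R gradient N x + \<beta> *\<^sub>R gradient N y) \<bullet> u \<le> \<gamma> * N u"
proof (cases "u = 0")
  case True
  have "N 0 = 0" using N by (simp add: smooth_norm_def is_norm_def)
  then show ?thesis using True by simp
next
  case u: False
  show ?thesis
  proof (rule ccontr)
    assume neg: "\<not> ?thesis"
    let ?f = "\<lambda>e. \<alpha> * N (x - e *\<^sub>R u) + \<beta> * N (y - e *\<^sub>R u) + \<gamma> * (e * N u)"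
    have nd: "is_norm N" "N differentiable (at x)" "N differentiable (at y)"
      using N x y by (auto simp: smooth_norm_def)
    have "(?f has_real_derivative
        \<alpha> * - (gradient N x \<bullet> u) + \<beta> * - (gradient N y \<bullet> u) + \<gamma> * N u) (at 0)"
      using has_real_derivative_along[OF nd(2), of u] has_real_derivative_along[OF nd(3), of u]
      by (auto intro!: derivative_eq_intros)
    moreover have "\<alpha> * - (gradient N x \<bullet> u) + \<beta> * - (gradient N y \<bullet> u) + \<gamma> * N u < 0"
      using neg by (simp add: inner_add_left)
    ultimately obtain r where r: "r > 0" "\<And>k. 0 < k \<Longrightarrow> k < r \<Longrightarrow> ?f k < ?f 0"
      using has_real_derivative_neg_dec_right[of ?f _ 0 UNIV] by auto
    have "inj (\<lambda>e. s + e *\<^sub>R u)" using u by (auto simp: inj_on_def)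
    then have "finite {e. s + e *\<^sub>R u \<in> V}" using finite_vimageI[OF fin] by (simp add: vimage_def)
    moreover have "infinite {0<..<r}" using r(1) infinite_Ioo by blast
    ultimately obtain e where e: "e \<in> {0<..<r}" "s + e *\<^sub>R u \<notin> V"
      by (metis (mono_tags, lifting) finite_subset mem_Collect_eq subsetI)
    have "N (e *\<^sub>R u) = \<bar>e\<bar> * N u" using nd unfolding is_norm_def by blast
    then show False using min[of e] r(2)[of e] e by auto
  qed
qed

locale minimal_rooted = rooted V q par rk
  for V :: "(real^2) set" and q par rk +
  fixes N :: "real^2 \<Rightarrow> real" and d h :: real and n :: nat and p :: "nat \<Rightarrow> real^2"
    and t :: "nat \<Rightarrow> real" and s :: "real^2"
  assumes smooth: "smooth_norm N" and d: "d > 0" and h: "h \<ge> 0"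
    and t: "\<And>i. i \<in> {1..n} \<Longrightarrow> t i > 0"
    and minimum: "minimum_gilbert_arborescence N (\<lambda>x. d + h * x) n p t q V edges"
    and steiner: "s \<in> steiner_points n p q V"
begin

abbreviation "F \<equiv> load n p t"
abbreviation "w x \<equiv> d + h * x"

lemma norm_N: "is_norm N" using smooth by (simp add: smooth_norm_def)

lemma N_sym: "N (x - y) = N (y - x)" 
  using is_norm_minus[OF norm_N, of "x - y"] by simp

lemma s_in: "s \<in> V" "s \<noteq> q" "s \<notin> terminals n p q"
  using steiner by (auto simp: steiner_points_def terminals_def)

lemma arborescence: "gilbert_arborescence n p q V edges"
  using minimum by (simp add: minimum_gilbert_arborescence_def)

lemma terminals_in: "terminals n p q \<subseteq> V - {s}"
  using arborescence s_in by (auto simp: gilbert_arborescence_def)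

lemma finite_children: "finite (children s)" using finite_V by (simp add: children_def)

lemma F_nonneg: "F v \<ge> 0"
  unfolding load_def using t by (intro sum_nonneg) (simp add: less_imp_le)

text \<open>Only the edges at \<open>s\<close> and the new edge are affected by a split, so the comparison of total costs
  reduces to these edges.\<close>

lemma split_not_cheaper:
  assumes new: "s' \<notin> V" and yz: "{y, z} = {s, s'}" and B: "B \<subseteq> children s" and ne: "B \<noteq> {}"
  shows "w (F s) * N (s - par s) + (\<Sum>c\<in>children s. w (F c) * N (c - s))
    \<le> w (F s) * N (y - par s) + (\<Sum>c\<in>children s. w (F c) * N (c - (if c \<in> B then z else y)))
      + w (\<Sum>b\<in>B. F b) * N (z - y)"
proof -
  interpret rooted_split V q par rk s s' y z B
    using s_in new yz B by unfold_locales auto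
  have T: "terminals n p q \<subseteq> V" "terminals n p q \<subseteq> insert s' V" using terminals_in by auto
  let ?R = "V - {q} - {s} - children s"
  have ch: "children s \<subseteq> V - {q} - {s}" using rk_par s_in by (force simp: children_def)
  have fin: "finite (V - {q})" "finite (V - {q} - {s})" using finite_V by auto
  have "cost N w n p t q V edges = (\<Sum>v\<in>V - {q}. w (F v) * N (v - par v))"
    using cost_rooted[OF rooted_axioms norm_N T(1)] .
  also have "\<dots> = w (F s) * N (s - par s) + (\<Sum>v\<in>V - {q} - {s}. w (F v) * N (v - par v))"
    using s_in fin by (intro sum.remove) auto
  also have "(\<Sum>v\<in>V - {q} - {s}. w (F v) * N (v - par v))
      = (\<Sum>v\<in>?R. w (F v) * N (v - par v)) + (\<Sum>v\<in>children s. w (F v) * N (v - par v))"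
    using sum.subset_diff[OF ch fin(2)] .
  also have "(\<Sum>v\<in>children s. w (F v) * N (v - par v)) = (\<Sum>v\<in>children s. w (F v) * N (v - s))"
    by (intro sum.cong) (auto simp: children_def)
  finally have old: "cost N w n p t q V edges = w (F s) * N (s - par s)
    + ((\<Sum>v\<in>?R. w (F v) * N (v - par v)) + (\<Sum>v\<in>children s. w (F v) * N (v - s)))" .
  let ?t = "\<lambda>v. w (new.load n p t v) * N (v - split_par v)"
  have V': "insert s' V - {q} = insert y (insert z (V - {q} - {s}))" "z \<notin> V - {q} - {s}"
    "y \<notin> insert z (V - {q} - {s})"
    using split_V yz_neq in_old by auto
  have "cost N w n p t q (insert s' V) new.edges = (\<Sum>v\<in>insert s' V - {q}. ?t v)"
    using cost_rooted[OF new.rooted_axioms norm_N T(2)] .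
  also have "\<dots> = ?t y + (?t z + (\<Sum>v\<in>V - {q} - {s}. ?t v))"
    unfolding V'(1) using V'(2,3) fin(2) by simp
  also have "(\<Sum>v\<in>V - {q} - {s}. ?t v) = (\<Sum>v\<in>?R. ?t v) + (\<Sum>v\<in>children s. ?t v)"
    using sum.subset_diff[OF ch fin(2)] .
  also have "(\<Sum>v\<in>?R. ?t v) = (\<Sum>v\<in>?R. w (F v) * N (v - par v))"
  proof (intro sum.cong refl)
    fix v assume v: "v \<in> ?R"
    then have "split_par v = par v" using split_par_old[of v] B by (auto simp: children_def)
    then show "?t v = w (F v) * N (v - par v)" using split_load(1)[OF terminals_in, of v] v by auto
  qed
  also have "(\<Sum>v\<in>children s. ?t v) = (\<Sum>v\<in>children s. w (F v) * N (v - (if v \<in> B then z else y)))"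
  proof (intro sum.cong refl)
    fix v assume v: "v \<in> children s"
    then have "v \<in> V - {s}" "v \<noteq> q" "par v = s" using ch by (auto simp: children_def)
    then show "?t v = w (F v) * N (v - (if v \<in> B then z else y))"
      using split_load(1)[OF terminals_in, of v] split_par_old[of v] by auto
  qed
  also have "?t y = w (F s) * N (y - par s)"
    using split_load(2)[OF terminals_in] yz_neq by (simp add: split_par_def)
  also have "?t z = w (\<Sum>b\<in>B. F b) * N (z - y)"
    using split_load(3)[OF terminals_in] by (simp add: split_par_def)
  finally have "cost N w n p t q (insert s' V) new.edges = w (F s) * N (y - par s)
    + (w (\<Sum>b\<in>B. F b) * N (z - y) + ((\<Sum>v\<in>?R. w (F v) * N (v - par v))
    + (\<Sum>v\<in>children s. w (F v) * N (v - (if v \<in> B then z else y)))))" .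
  moreover have "cost N w n p t q V edges \<le> cost N w n p t q (insert s' V) new.edges"
    using minimum split_arborescence[OF arborescence s_in(3) ne]
    by (simp add: minimum_gilbert_arborescence_def)
  ultimately show ?thesis using old by linarith
qed

lemma child_neq: "c \<in> children s \<Longrightarrow> c - s \<noteq> 0"
  using rk_par[of c] by (auto simp: children_def)

lemma parent_neq: "par s - s \<noteq> 0"
  using rk_par[OF s_in(1,2)] by auto

text \<open>The children \<open>j\<close> and \<open>k\<close> are moved to a new child of \<open>s\<close>.\<close>

lemma pair_inequality:
  assumes jk: "j \<in> children s" "k \<in> children s" "j \<noteq> k"
  shows "(w (F j) *\<^sub>R gradient N (j - s) + w (F k) *\<^sub>R gradient N (k - s)) \<bullet> u \<le> w (F j + F k) * N u"
proof (rule two_edges_first_variation[OF smooth child_neq[OF jk(1)] child_neq[OF jk(2)] finite_V])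
  fix e :: real assume e: "s + e *\<^sub>R u \<notin> V"
  let ?D = "children s - {j, k}"
  have sum: "(\<Sum>c\<in>children s. f c) = f j + f k + sum f ?D" for f :: "_ \<Rightarrow> real"
    using sum.subset_diff[of "{j, k}" "children s" f] jk finite_children by auto
  have D: "(\<Sum>c\<in>?D. w (F c) * N (c - (if c \<in> {j, k} then s + e *\<^sub>R u else s)))
    = (\<Sum>c\<in>?D. w (F c) * N (c - s))" by (intro sum.cong) auto
  show "w (F j) * N (j - s) + w (F k) * N (k - s)
    \<le> w (F j) * N (j - s - e *\<^sub>R u) + w (F k) * N (k - s - e *\<^sub>R u) + w (F j + F k) * N (e *\<^sub>R u)"
    using split_not_cheaper[OF e, of s "s + e *\<^sub>R u" "{j, k}"] jk unfolding sum D
    by (simp add: diff_diff_eq)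
qed

text \<open>All children except \<open>k\<close> stay at the old position, which becomes a child of a new point carrying
  \<open>k\<close> and the outgoing edge.\<close>

lemma out_inequality:
  assumes k: "k \<in> children s" and ne: "children s \<noteq> {k}"
  shows "(w (F s) *\<^sub>R gradient N (par s - s) + w (F k) *\<^sub>R gradient N (k - s)) \<bullet> u
    \<le> w (F s - F k) * N u"
proof (rule two_edges_first_variation[OF smooth parent_neq child_neq[OF k] finite_V])
  fix e :: real assume e: "s + e *\<^sub>R u \<notin> V"
  let ?D = "children s - {k}"
  have sum: "(\<Sum>c\<in>children s. f c) = f k + sum f ?D" for f :: "_ \<Rightarrow> real"
    using sum.remove[OF finite_children k] .
  have D: "(\<Sum>c\<in>?D. w (F c) * N (c - (if c \<in> ?D then s else s + e *\<^sub>R u)))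
    = (\<Sum>c\<in>?D. w (F c) * N (c - s))" by (intro sum.cong) auto
  have D_ne: "?D \<noteq> {}" using k ne by auto
  have "sum F ?D = F s - F k"
    using load_children[OF terminals_in] sum[of F] by simp
  moreover have "N (s - (s + e *\<^sub>R u)) = N (e *\<^sub>R u)" using is_norm_minus[OF norm_N] by simp
  moreover have "N (s + e *\<^sub>R u - par s) = N (par s - s - e *\<^sub>R u)"
    using N_sym[of "s + e *\<^sub>R u"] by (simp add: diff_diff_eq)
  ultimately show "w (F s) * N (par s - s) + w (F k) * N (k - s)
    \<le> w (F s) * N (par s - s - e *\<^sub>R u) + w (F k) * N (k - s - e *\<^sub>R u) + w (F s - F k) * N (e *\<^sub>R u)"
    using split_not_cheaper[OF e, of "s + e *\<^sub>R u" s ?D] D_ne k unfolding sum D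
    by (simp add: diff_diff_eq N_sym[of s "par s"] insert_commute)
qed

lemma card_children_le: "card (children s) \<le> 2"
proof (cases "\<exists>k. children s = {k}")
  case False
  interpret split_conditions N d h "F s" "par s - s" "children s" "\<lambda>c. c - s" F
    using smooth d h parent_neq child_neq F_nonneg pair_inequality out_inequality False
    by unfold_locales auto
  show ?thesis by (rule at_most_two_in)
qed auto

end

theorem theorem2:
  fixes N :: "real^2 \<Rightarrow> real"
    and d h :: real
    and n :: nat
    and p :: "nat \<Rightarrow> real^2"
    and t :: "nat \<Rightarrow> real"
    and q :: "real^2"
    and V :: "(real^2) set"
    and E :: "(real^2) set set"
    and s :: "real^2"
  assumes "smooth_norm N"
    and "d > 0" and "h \<ge> 0"
    and "\<And>i. i \<in> {1..n} \<Longrightarrow> t i > 0"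
    and "minimum_gilbert_arborescence N (\<lambda>x. d + h * x) n p t q V E"
    and "s \<in> steiner_points n p q V"
    and "vertex_degree E s \<ge> 3"
  shows "vertex_degree E s = 3"
proof -
  have "is_tree V E" "q \<in> V"
    using assms(5) by (auto simp: minimum_gilbert_arborescence_def gilbert_arborescence_def terminals_def)
  then obtain par rk where R: "rooted V q par rk" and E: "E = rooted.edges V q par"
    by (rule is_tree_rooted)
  interpret rooted V q par rk by (fact R)
  interpret minimal_rooted V q par rk N d h n p t s
    using assms(1-6) unfolding E by unfold_locales
  show ?thesis using vertex_degree_le[of s] card_children_le assms(7) E by simp
qed

end
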